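(* Let $\mathcal S$ be a finite generalized quadrangle of order $(s,s)$ with flag set $\Omega$ and relations $R_0,\dots,R_7$ as in the context, and put $S_0=R_0$, $S_1=R_1\cup R_2$, $S_2=R_3\cup R_4$, $S_3=R_5\cup R_6$, $S_4=R_7$. Then $\mathcal Y=(\Omega,\{S_0,\dots,S_4\})$ is a symmetric, primitive association scheme of order $(s+1)^2(s^2+1)$ and class $4$, with valencies $\eta_1=2s$, $\eta_2=2s^2$, $\eta_3=2s^3$, $\eta_4=s^4$, and with intersection numbers $p^k_{ij}$ given as the $(i,j)$-entry ($i,j=0,\dots,4$) of the matrix $M_k$: $M_1=\begin{pmatrix}0&1&0&0&0\\1&s-1&s&0&0\\0&s&s(s-1)&s^2&0\\0&0&s^2&s^2(s-1)&s^3\\0&0&0&s^3&s^3(s-1)\end{pmatrix}$, $M_2=\begin{pmatrix}0&0&1&0&0\\0&1&s-1&s&0\\1&s-1&0&s(s-1)&s^2\\0&s&s(s-1)&s^2&2s^2(s-1)\\0&0&s^2&2s^2(s-1)&s^2(s-1)^2\end{pmatrix}$, $M_3=\begin{pmatrix}0&0&0&1&0\\0&0&1&s-1&s\\0&1&s-1&s&2s(s-1)\\1&s-1&s&4s(s-1)&2s(s-1)^2\\0&s&2s(s-1)&2s(s-1)^2&s(s-1)(s^2-s+1)\end{pmatrix}$, $M_4=\begin{pmatrix}0&0&0&0&1\\0&0&0&2&2(s-1)\\0&0&2&4(s-1)&2(s-1)^2\\0&2&4(s-1)&4(s-1)^2&2(s-1)(s^2-s+1)\\1&2(s-1)&2(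s-1)^2&2(s-1)(s^2-s+1)&s^4-2s^3+2s^2-2s+1\end{pmatrix}$.
   Context: A finite generalized quadrangle of order $(s,t)$ is an incidence structure of points and lines in which each point is on $t+1$ lines, each line has $s+1$ points, two distinct points lie on at most one common line, two distinct lines share at most one point, and for every non-incident point $p$ and line $L$ there is a unique pair $(q,M)$ with $p\,\mathrm I\,M\,\mathrm I\,q\,\mathrm I\,L$. $\Omega$ is the set of flags (incident pairs $(p,L)$), $R_0$ the diagonal, and for flags $(p,L),(q,M)$: $R_1$: $p=q$, $L\ne M$; $R_2$: $L=M$, $p\ne q$; $R_3$: $p\ne q$ collinear on $L$, $M\ne L$; $R_4$: $p\neq q$ collinear on $M$, $L\neq M$; $R_5$: $p\ne q$ collinear on a line different from $L$ and $M$; $R_6$: $L\ne M$ meet in a point $r\ne p,q$; $R_7$: $L,M$ disjoint and $p,q$ not collinear. For an association scheme, the valency $\eta_i$ is the number of $y$ with $(x,y)$ in the $i$-th relation, and $p^k_{ij}$ is the number of $z$ with $(x,z)\in S_i$, $(z,y)\in S_j$ when $(x,y)\in S_k$. Symmetric means every relation equals its converse; primitive means the only unions of relations that are equivalence relations are $S_0$ and $\Omega\times\Omega$.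
   Formalization: Primitivity is claimed only for s ≥ 2, since for s = 1 (the ordinary quadrangle) S_0 ∪ S_4 is a nontrivial equivalence relation; the quadrangle is also taken to be nonempty with s ≥ 1. *)

theory Defs
  imports Main
begin

text \<open>Point set \<open>P\<close>, line set \<open>B\<close>, incidence \<open>inc\<close>. As usual, incidence structures have points and
  \<open>s, t \<ge> 1\<close>; the remaining axioms alone also hold for the empty structure (any \<open>s, t\<close>) and for
  a single flag (\<open>s = t = 0\<close>). Lines exist because every point is on \<open>t + 1\<close> of them.\<close>

locale generalized_quadrangle =
  fixes P :: "'p set" and B :: "'l set" and inc :: "'p \<Rightarrow> 'l \<Rightarrow> bool" and s t :: nat
  assumes finite_points: "finite P"
    and finite_lines: "finite B"
    and points_nonempty: "P \<noteq> {}"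
    and s_pos: "s \<ge> 1"
    and t_pos: "t \<ge> 1"
    and point_degree: "p \<in> P \<Longrightarrow> card {L \<in> B. inc p L} = t + 1"
    and line_size: "L \<in> B \<Longrightarrow> card {p \<in> P. inc p L} = s + 1"
    and at_most_one_line:
      "\<lbrakk>p \<in> P; q \<in> P; p \<noteq> q; L \<in> B; M \<in> B; inc p L; inc q L; inc p M; inc q M\<rbrakk> \<Longrightarrow> L = M"
    and at_most_one_point:
      "\<lbrakk>L \<in> B; M \<in> B; L \<noteq> M; p \<in> P; q \<in> P; inc p L; inc p M; inc q L; inc q M\<rbrakk> \<Longrightarrow> p = q"
    and projection:
      "\<lbrakk>p \<in> P; L \<in> B; \<not> inc p L\<rbrakk> \<Longrightarrow>
        \<exists>!(q, M). q \<in> P \<and> M \<in> B \<and> inc p M \<and> inc q M \<and> inc q L"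

definition flags :: "'p set \<Rightarrow> 'l set \<Rightarrow> ('p \<Rightarrow> 'l \<Rightarrow> bool) \<Rightarrow> ('p \<times> 'l) set" where
  "flags P B inc = {(p, L). p \<in> P \<and> L \<in> B \<and> inc p L}"

type_synonym ('p, 'l) flag_rel = "(('p \<times> 'l) \<times> ('p \<times> 'l)) set"

definition R0 :: "'p set \<Rightarrow> 'l set \<Rightarrow> ('p \<Rightarrow> 'l \<Rightarrow> bool) \<Rightarrow> ('p, 'l) flag_rel" where
  "R0 P B inc = Id_on (flags P B inc)"

definition R1 :: "'p set \<Rightarrow> 'l set \<Rightarrow> ('p \<Rightarrow> 'l \<Rightarrow> bool) \<Rightarrow> ('p, 'l) flag_rel" where
  "R1 P B inc = {((p, L), (q, M)). (p, L) \<in> flags P B inc \<and> (q, M) \<in> flags P B inc \<and>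
     p = q \<and> L \<noteq> M}"

definition R2 :: "'p set \<Rightarrow> 'l set \<Rightarrow> ('p \<Rightarrow> 'l \<Rightarrow> bool) \<Rightarrow> ('p, 'l) flag_rel" where
  "R2 P B inc = {((p, L), (q, M)). (p, L) \<in> flags P B inc \<and> (q, M) \<in> flags P B inc \<and>
     L = M \<and> p \<noteq> q}"

definition R3 :: "'p set \<Rightarrow> 'l set \<Rightarrow> ('p \<Rightarrow> 'l \<Rightarrow> bool) \<Rightarrow> ('p, 'l) flag_rel" where
  "R3 P B inc = {((p, L), (q, M)). (p, L) \<in> flags P B inc \<and> (q, M) \<in> flags P B inc \<and>
     p \<noteq> q \<and> inc p L \<and> inc q L \<and> M \<noteq> L}"

definition R4 :: "'p set \<Rightarrow> 'l set \<Rightarrow> ('p \<Rightarrow> 'l \<Rightarrow> bool) \<Rightarrow> ('p, 'l) flag_rel" where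
  "R4 P B inc = {((p, L), (q, M)). (p, L) \<in> flags P B inc \<and> (q, M) \<in> flags P B inc \<and>
     p \<noteq> q \<and> inc p M \<and> inc q M \<and> L \<noteq> M}"

definition R5 :: "'p set \<Rightarrow> 'l set \<Rightarrow> ('p \<Rightarrow> 'l \<Rightarrow> bool) \<Rightarrow> ('p, 'l) flag_rel" where
  "R5 P B inc = {((p, L), (q, M)). (p, L) \<in> flags P B inc \<and> (q, M) \<in> flags P B inc \<and>
     p \<noteq> q \<and> (\<exists>N\<in>B. inc p N \<and> inc q N \<and> N \<noteq> L \<and> N \<noteq> M)}"

definition R6 :: "'p set \<Rightarrow> 'l set \<Rightarrow> ('p \<Rightarrow> 'l \<Rightarrow> bool) \<Rightarrow> ('p, 'l) flag_rel" where
  "R6 P B inc = {((p, L), (q, M)). (p, L) \<in> flags P B inc \<and> (q, M) \<in> flags P B inc \<and>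
     L \<noteq> M \<and> (\<exists>r\<in>P. inc r L \<and> inc r M \<and> r \<noteq> p \<and> r \<noteq> q)}"

definition R7 :: "'p set \<Rightarrow> 'l set \<Rightarrow> ('p \<Rightarrow> 'l \<Rightarrow> bool) \<Rightarrow> ('p, 'l) flag_rel" where
  "R7 P B inc = {((p, L), (q, M)). (p, L) \<in> flags P B inc \<and> (q, M) \<in> flags P B inc \<and>
     \<not> (\<exists>r\<in>P. inc r L \<and> inc r M) \<and> \<not> (\<exists>N\<in>B. inc p N \<and> inc q N)}"

definition fused_rel :: "'p set \<Rightarrow> 'l set \<Rightarrow> ('p \<Rightarrow> 'l \<Rightarrow> bool) \<Rightarrow> nat \<Rightarrow> ('p, 'l) flag_rel" where
  "fused_rel P B inc k =
     [R0 P B inc,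
      R1 P B inc \<union> R2 P B inc,
      R3 P B inc \<union> R4 P B inc,
      R5 P B inc \<union> R6 P B inc,
      R7 P B inc] ! k"

text \<open>In the notions below, a scheme of class \<open>d\<close> on \<open>X\<close> is given by its relations
  \<open>S 0, \<dots>, S d\<close>; values of \<open>S\<close> beyond \<open>d\<close> are irrelevant.\<close>

definition is_valency :: "'a set \<Rightarrow> (nat \<Rightarrow> ('a \<times> 'a) set) \<Rightarrow> nat \<Rightarrow> nat \<Rightarrow> bool" where
  "is_valency X S i n \<longleftrightarrow> (\<forall>x\<in>X. card {y \<in> X. (x, y) \<in> S i} = n)"

text \<open>\<open>is_intersection_number X S k i j n\<close> says that $p^k_{ij} = n$; \<open>n\<close> is an integer only so that
  it can be an entry of the matrices below.\<close>

definition is_intersection_number ::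
  "'a set \<Rightarrow> (nat \<Rightarrow> ('a \<times> 'a) set) \<Rightarrow> nat \<Rightarrow> nat \<Rightarrow> nat \<Rightarrow> int \<Rightarrow> bool" where
  "is_intersection_number X S k i j n \<longleftrightarrow>
     (\<forall>(x, y)\<in>S k. int (card {z \<in> X. (x, z) \<in> S i \<and> (z, y) \<in> S j}) = n)"

text \<open>Commutativity is not part of the notion; it follows for symmetric schemes.\<close>

definition association_scheme :: "'a set \<Rightarrow> nat \<Rightarrow> (nat \<Rightarrow> ('a \<times> 'a) set) \<Rightarrow> bool" where
  "association_scheme X d S \<longleftrightarrow>
     finite X \<and> X \<noteq> {} \<and>
     S 0 = Id_on X \<and>
     (\<forall>i\<le>d. S i \<noteq> {}) \<and>
     (\<Union>i\<le>d. S i) = X \<times> X \<and>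
     (\<forall>i\<le>d. \<forall>j\<le>d. i \<noteq> j \<longrightarrow> S i \<inter> S j = {}) \<and>
     (\<forall>i\<le>d. \<exists>j\<le>d. (S i)\<inverse> = S j) \<and>
     (\<forall>k\<le>d. \<forall>i\<le>d. \<forall>j\<le>d. \<exists>n. is_intersection_number X S k i j n)"

definition symmetric_scheme :: "nat \<Rightarrow> (nat \<Rightarrow> ('a \<times> 'a) set) \<Rightarrow> bool" where
  "symmetric_scheme d S \<longleftrightarrow> (\<forall>i\<le>d. (S i)\<inverse> = S i)"

definition primitive_scheme :: "'a set \<Rightarrow> nat \<Rightarrow> (nat \<Rightarrow> ('a \<times> 'a) set) \<Rightarrow> bool" where
  "primitive_scheme X d S \<longleftrightarrow>
     (\<forall>J\<subseteq>{..d}. equiv X (\<Union>i\<in>J. S i) \<longrightarrow> (\<Union>i\<in>J. S i) = S 0 \<or> (\<Union>i\<in>J. S i) = X \<times> X)"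

text \<open>Matrices are lists of rows, indexed from 0; entries are integers so that subtraction is
  the usual one.\<close>

definition M1 :: "int \<Rightarrow> int list list" where
  "M1 s =
    [[0, 1, 0, 0, 0],
     [1, s - 1, s, 0, 0],
     [0, s, s * (s - 1), s^2, 0],
     [0, 0, s^2, s^2 * (s - 1), s^3],
     [0, 0, 0, s^3, s^3 * (s - 1)]]"

definition M2 :: "int \<Rightarrow> int list list" where
  "M2 s =
    [[0, 0, 1, 0, 0],
     [0, 1, s - 1, s, 0],
     [1, s - 1, 0, s * (s - 1), s^2],
     [0, s, s * (s - 1), s^2, 2 * s^2 * (s - 1)],
     [0, 0, s^2, 2 * s^2 * (s - 1), s^2 * (s - 1)^2]]"

definition M3 :: "int \<Rightarrow> int list list" where
  "M3 s =
    [[0, 0, 0, 1, 0],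
     [0, 0, 1, s - 1, s],
     [0, 1, s - 1, s, 2 * s * (s - 1)],
     [1, s - 1, s, 4 * s * (s - 1), 2 * s * (s - 1)^2],
     [0, s, 2 * s * (s - 1), 2 * s * (s - 1)^2, s * (s - 1) * (s^2 - s + 1)]]"

definition M4 :: "int \<Rightarrow> int list list" where
  "M4 s =
    [[0, 0, 0, 0, 1],
     [0, 0, 0, 2, 2 * (s - 1)],
     [0, 0, 2, 4 * (s - 1), 2 * (s - 1)^2],
     [0, 2, 4 * (s - 1), 4 * (s - 1)^2, 2 * (s - 1) * (s^2 - s + 1)],
     [1, 2 * (s - 1), 2 * (s - 1)^2, 2 * (s - 1) * (s^2 - s + 1),
      s^4 - 2 * s^3 + 2 * s^2 - 2 * s + 1]]"

end

theory Submission
  imports Defs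
begin

text \<open>The flags of a generalized quadrangle of order \<open>(s, s)\<close> are the points of a generalized octagon
  of order \<open>(s, 1)\<close>, whose lines are the pencils of flags sharing a point and the sets of flags
  sharing a line. For any flag \<open>y\<close>, each such line has a unique flag nearest to \<open>y\<close>, and all its other
  flags are one step further away. Consequently \<open>S\<^sub>0, \<dots>, S\<^sub>4\<close> are the distance relations of a
  distance-regular graph with intersection array \<open>{2s, s, s, s; 1, 1, 1, 2}\<close>, and all intersection
  numbers follow from the three-term recurrence for multiplication by the adjacency matrix.\<close>

section \<open>Intersection numbers from products with the first relation\<close>

definition M0 :: "int \<Rightarrow> int list list" where
  "M0 s =
    [[1, 0, 0, 0, 0],
     [0, 2 * s, 0, 0, 0],
     [0, 0, 2 * s^2, 0, 0],
     [0, 0, 0, 2 * s^3, 0],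
     [0, 0, 0, 0, s^4]]"

lemma le_4_iff: "(i::nat) \<le> 4 \<longleftrightarrow> i = 0 \<or> i = 1 \<or> i = 2 \<or> i = 3 \<or> i = 4"
  by auto

lemma sum_atMost_4: "(\<Sum>k\<le>(4::nat). f k) = f 0 + f 1 + f 2 + f 3 + (f 4 :: 'a :: comm_monoid_add)"
  by (simp add: numeral_eq_Suc)

text \<open>The collinearity graph of a generalized octagon of order \<open>(s, 1)\<close>, given by the products of its
  adjacency matrix with the distance matrices (\<open>adj\<close>).\<close>

locale octagon_relations =
  fixes X :: "'a set" and S :: "nat \<Rightarrow> ('a \<times> 'a) set" and s :: nat
    and adj :: "nat \<Rightarrow> 'a \<Rightarrow> 'a \<Rightarrow> int" and conv :: "nat \<Rightarrow> nat \<Rightarrow> 'a \<Rightarrow> 'a \<Rightarrow> int"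
  defines "adj i x y \<equiv> of_bool ((x, y) \<in> S i)"
    and "conv i j x y \<equiv> \<Sum>z\<in>X. adj i x z * adj j z y"
  assumes finite_X: "finite X" and X_nonempty: "X \<noteq> {}" and s_pos: "s \<ge> 1"
    and diagonal: "S 0 = Id_on X"
    and cover: "(\<Union>i\<le>4. S i) = X \<times> X"
    and disjoint: "\<lbrakk>i \<le> 4; j \<le> 4; i \<noteq> j\<rbrakk> \<Longrightarrow> S i \<inter> S j = {}"
    and symmetric: "i \<le> 4 \<Longrightarrow> (S i)\<inverse> = S i"
    and conv_1_1: "\<lbrakk>x \<in> X; y \<in> X\<rbrakk> \<Longrightarrow>
      conv 1 1 x y = 2 * int s * adj 0 x y + (int s - 1) * adj 1 x y + adj 2 x y"
    and conv_1_2: "\<lbrakk>x \<in> X; y \<in> X\<rbrakk> \<Longrightarrow>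
      conv 1 2 x y = int s * adj 1 x y + (int s - 1) * adj 2 x y + adj 3 x y"
    and conv_1_3: "\<lbrakk>x \<in> X; y \<in> X\<rbrakk> \<Longrightarrow>
      conv 1 3 x y = int s * adj 2 x y + (int s - 1) * adj 3 x y + 2 * adj 4 x y"
    and conv_1_4: "\<lbrakk>x \<in> X; y \<in> X\<rbrakk> \<Longrightarrow>
      conv 1 4 x y = int s * adj 3 x y + 2 * (int s - 1) * adj 4 x y"
begin

section \<open>Products of the distance matrices\<close>

lemma rel_subset: "i \<le> 4 \<Longrightarrow> S i \<subseteq> X \<times> X"
  using cover by blast

lemma conv_card: "conv i j x y = int (card {z \<in> X. (x, z) \<in> S i \<and> (z, y) \<in> S j})"
proof -
  have "conv i j x y = (\<Sum>z\<in>X. of_bool ((x, z) \<in> S i \<and> (z, y) \<in> S j))"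
    unfolding conv_def adj_def by (simp add: of_bool_conj)
  also have "\<dots> = int (card {z \<in> X. (x, z) \<in> S i \<and> (z, y) \<in> S j})"
    using finite_X by (simp add: Int_def)
  finally show ?thesis .
qed

lemma conv_0:
  assumes "x \<in> X"
  shows "conv 0 j x y = adj j x y"
proof -
  have "conv 0 j x y = (\<Sum>z\<in>X. if z = x then adj j x y else 0)"
    unfolding conv_def using assms by (intro sum.cong) (auto simp: adj_def diagonal)
  then show ?thesis
    using assms finite_X by simp
qed

lemma conv_1_0:
  assumes "x \<in> X" "y \<in> X"
  shows "conv 1 0 x y = adj 1 x y"
proof -
  have "conv 1 0 x y = (\<Sum>z\<in>X. if z = y then adj 1 x y else 0)"
    unfolding conv_def using assms by (intro sum.cong) (auto simp: adj_def diagonal)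
  then show ?thesis
    using assms finite_X by simp
qed

text \<open>Write A_i for the matrix of \<open>S i\<close>. This is (A_1 A_i) A_j = A_1 (A_i A_j),
  with A_1 A_i expanded by the three-term recurrence and then solved for the term with A_i'' A_j. It
  computes each row of products from the two rows before it.\<close>

lemma conv_1_assoc:
  assumes prod_i: "\<And>z. z \<in> X \<Longrightarrow>
      conv 1 i x z = b * adj i' x z + a * adj i x z + c * adj i'' x z"
    and prod_ij: "\<And>z. z \<in> X \<Longrightarrow> conv i j z y = (\<Sum>k\<le>4. u k * adj k z y)"
  shows "c * conv i'' j x y =
    (\<Sum>k\<le>4. u k * conv 1 k x y) - a * conv i j x y - b * conv i' j x y"
proof -
  have "(\<Sum>k\<le>4. u k * conv 1 k x y) = (\<Sum>z\<in>X. adj 1 x z * (\<Sum>k\<le>4. u k * adj k z y))"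
    unfolding conv_def sum_distrib_left
    by (subst sum.swap) (simp add: mult_ac)
  also have "\<dots> = (\<Sum>z\<in>X. adj 1 x z * conv i j z y)"
    by (simp add: prod_ij)
  also have "\<dots> = (\<Sum>w\<in>X. conv 1 i x w * adj j w y)"
    unfolding conv_def sum_distrib_left sum_distrib_right
    by (subst sum.swap) (simp add: mult_ac)
  also have "\<dots> = (\<Sum>w\<in>X. (b * adj i' x w + a * adj i x w + c * adj i'' x w) * adj j w y)"
    by (simp only: prod_i cong: sum.cong)
  also have "\<dots> = b * conv i' j x y + a * conv i j x y + c * conv i'' j x y"
    by (simp add: conv_def sum_distrib_left distrib_right sum.distrib mult.assoc)
  finally show ?thesis
    by simp
qed

section \<open>Solving the recurrence for all products\<close>

definition coeff :: "nat \<Rightarrow> nat \<Rightarrow> nat \<Rightarrow> int" where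
  "coeff k i j = [M0 (int s), M1 (int s), M2 (int s), M3 (int s), M4 (int s)] ! k ! i ! j"

lemmas conv_1 = conv_1_0 conv_1_1 conv_1_2 conv_1_3 conv_1_4
lemmas coeff_defs = coeff_def M0_def M1_def M2_def M3_def M4_def

lemma conv_eq_coeff_0:
  assumes "x \<in> X" "y \<in> X" "j \<le> 4"
  shows "conv 0 j x y = (\<Sum>k\<le>4. coeff k 0 j * adj k x y)"
  using assms(3) unfolding le_4_iff
  by (elim disjE) (simp_all add: conv_0[OF assms(1)] sum_atMost_4 coeff_defs)

lemma conv_eq_coeff_1:
  assumes "x \<in> X" "y \<in> X" "j \<le> 4"
  shows "conv 1 j x y = (\<Sum>k\<le>4. coeff k 1 j * adj k x y)"
  using assms(3) unfolding le_4_iff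
  by (elim disjE)
    (simp_all only: conv_1[OF assms(1,2)], simp_all add: sum_atMost_4 coeff_defs)

text \<open>Uses A_2 = A_1 A_1 - (s - 1) A_1 - 2s A_0. The products A_1 A_k that arise are known
  from the recurrence, so each j leaves a polynomial identity in s. The next two lemmas proceed
  likewise from the recurrences for A_1 A_2 and A_1 A_3.\<close>

lemma conv_eq_coeff_2:
  assumes xy: "x \<in> X" "y \<in> X" and j: "j \<le> 4"
  shows "conv 2 j x y = (\<Sum>k\<le>4. coeff k 2 j * adj k x y)"
proof -
  have "1 * conv 2 j x y = (\<Sum>k\<le>4. coeff k 1 j * conv 1 k x y)
      - (int s - 1) * conv 1 j x y - (2 * int s) * conv 0 j x y"
    using xy j by (intro conv_1_assoc) (simp_all only: conv_1_1 mult_1, simp_all only: conv_eq_coeff_1)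
  then show ?thesis
    using j unfolding le_4_iff
    by (elim disjE; simp only: sum_atMost_4 conv_1[OF xy] conv_0[OF xy(1)])
      (simp_all add: coeff_defs algebra_simps power_numeral_reduce)
qed

lemma conv_eq_coeff_3:
  assumes xy: "x \<in> X" "y \<in> X" and j: "j \<le> 4"
  shows "conv 3 j x y = (\<Sum>k\<le>4. coeff k 3 j * adj k x y)"
proof -
  have "1 * conv 3 j x y = (\<Sum>k\<le>4. coeff k 2 j * conv 1 k x y)
      - (int s - 1) * conv 2 j x y - int s * conv 1 j x y"
    using xy j by (intro conv_1_assoc) (simp_all only: conv_1_2 conv_eq_coeff_2 mult_1)
  then show ?thesis
    using j unfolding conv_eq_coeff_2[OF xy j] le_4_iff
    by (elim disjE; simp only: sum_atMost_4 conv_1[OF xy])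
      (simp_all add: coeff_defs algebra_simps power_numeral_reduce)
qed

lemma conv_eq_coeff_4:
  assumes xy: "x \<in> X" "y \<in> X" and j: "j \<le> 4"
  shows "conv 4 j x y = (\<Sum>k\<le>4. coeff k 4 j * adj k x y)"
proof -
  have "2 * conv 4 j x y = (\<Sum>k\<le>4. coeff k 3 j * conv 1 k x y)
      - (int s - 1) * conv 3 j x y - int s * conv 2 j x y"
    using xy j by (intro conv_1_assoc) (simp_all only: conv_1_3 conv_eq_coeff_3)
  \<comment> \<open>A_4 enters A_1 A_3 with coefficient 2, since an opposite flag is reached through
    both of its lines. The identity is therefore compared in doubled form over the integers and 2 is
    cancelled afterwards.\<close>
  then have "2 * conv 4 j x y = 2 * (\<Sum>k\<le>4. coeff k 4 j * adj k x y)"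
    using j unfolding conv_eq_coeff_2[OF xy j] conv_eq_coeff_3[OF xy j] le_4_iff
    by (elim disjE; simp only: sum_atMost_4 conv_1[OF xy])
      (simp_all add: coeff_defs algebra_simps power_numeral_reduce)
  then show ?thesis
    by simp
qed

lemma adj_rel:
  assumes "(x, y) \<in> S k" "k \<le> 4" "i \<le> 4"
  shows "adj i x y = of_bool (i = k)"
  using assms disjoint[of i k] by (auto simp: adj_def)

text \<open>On a pair in \<open>S k\<close> every \<open>adj l\<close> with l different from k is 0
  by disjointness, so the linear combination collapses to one coefficient. If \<open>S k\<close>
  were empty the claim would be vacuous, so nonemptiness may be derived later from the
  valencies.\<close>

lemma intersection_number:
  assumes "k \<le> 4" "i \<le> 4" "j \<le> 4"
  shows "is_intersection_number X S k i j (coeff k i j)"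
  unfolding is_intersection_number_def
proof (intro ballI, clarify)
  fix x y
  assume k: "(x, y) \<in> S k"
  then have xy: "x \<in> X" "y \<in> X"
    using rel_subset assms by auto
  have "conv i j x y = (\<Sum>l\<le>4. coeff l i j * adj l x y)"
    using assms(2) conv_eq_coeff_0[OF xy assms(3)] conv_eq_coeff_1[OF xy assms(3)]
      conv_eq_coeff_2[OF xy assms(3)] conv_eq_coeff_3[OF xy assms(3)]
      conv_eq_coeff_4[OF xy assms(3)]
    unfolding le_4_iff by blast
  also have "\<dots> = (\<Sum>l\<le>4. if l = k then coeff k i j else 0)"
    using assms k by (intro sum.cong) (auto simp: adj_rel)
  also have "\<dots> = coeff k i j"
    using assms by simp
  finally show "int (card {z \<in> X. (x, z) \<in> S i \<and> (z, y) \<in> S j}) = coeff k i j"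
    by (simp add: conv_card)
qed

section \<open>Valencies and order\<close>

lemma valency:
  assumes "i \<le> 4"
  shows "is_valency X S i (nat (coeff 0 i i))"
  unfolding is_valency_def
proof
  fix x
  assume x: "x \<in> X"
  \<comment> \<open>By symmetry the valency of \<open>S i\<close> is $p^0_{ii}$, read off at the
    diagonal pair (x, x).\<close>
  have "{y \<in> X. (x, y) \<in> S i} = {z \<in> X. (x, z) \<in> S i \<and> (z, x) \<in> S i}"
    using symmetric[OF assms] by blast
  then have "int (card {y \<in> X. (x, y) \<in> S i}) = coeff 0 i i"
    using intersection_number[of 0 i i] assms x
    by (simp add: is_intersection_number_def diagonal Id_on_def)
  then show "card {y \<in> X. (x, y) \<in> S i} = nat (coeff 0 i i)"
    by simp
qed

lemma valencies:
  "is_valency X S 0 1" "is_valency X S 1 (2 * s)" "is_valency X S 2 (2 * s^2)"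
  "is_valency X S 3 (2 * s^3)" "is_valency X S 4 (s^4)"
  using valency[of 0] valency[of 1] valency[of 2] valency[of 3] valency[of 4]
  by (simp_all add: coeff_def M0_def nat_mult_distrib nat_power_eq)

lemma card_X: "card X = (s + 1)^2 * (s^2 + 1)"
proof -
  obtain x where x: "x \<in> X"
    using X_nonempty by blast
  have "X = (\<Union>i\<le>4. {y \<in> X. (x, y) \<in> S i})"
    using cover x by blast
  also have "card \<dots> = (\<Sum>i\<le>4. card {y \<in> X. (x, y) \<in> S i})"
  proof (rule card_UN_disjoint)
    show "\<forall>i\<in>{..4}. \<forall>j\<in>{..4}. i \<noteq> j \<longrightarrow>
        {y \<in> X. (x, y) \<in> S i} \<inter> {y \<in> X. (x, y) \<in> S j} = {}"
      using disjoint by fastforce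
  qed (use finite_X in auto)
  also have "\<dots> = 1 + 2 * s + 2 * s^2 + 2 * s^3 + s^4"
    unfolding sum_atMost_4 using valencies x by (simp add: is_valency_def)
  also have "\<dots> = (s + 1)^2 * (s^2 + 1)"
    by (simp add: algebra_simps power_numeral_reduce)
  finally show ?thesis .
qed

lemma rel_nonempty:
  assumes "i \<le> 4"
  shows "S i \<noteq> {}"
proof
  assume empty: "S i = {}"
  obtain x where "x \<in> X"
    using X_nonempty by blast
  with valencies empty assms s_pos show False
    unfolding le_4_iff is_valency_def by auto
qed

section \<open>Scheme axioms and primitivity\<close>

lemma scheme: "association_scheme X 4 S"
  unfolding association_scheme_def
proof (intro conjI allI impI)
  show "\<exists>j\<le>4. (S i)\<inverse> = S j" if "i \<le> 4" for i
    using symmetric that by blast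
  show "\<exists>n. is_intersection_number X S k i j n" if "k \<le> 4" "i \<le> 4" "j \<le> 4" for k i j
    using intersection_number that by blast
qed (simp_all add: finite_X X_nonempty diagonal rel_nonempty cover disjoint)

text \<open>A positive $p^k_{ij}$ places a pair of \<open>S k\<close> in the composition of
  \<open>S i\<close> and \<open>S j\<close>. Transitivity puts that pair in the union over
  \<open>J\<close>, and disjointness of the relations turns this into membership of k.\<close>

lemma rel_in_equiv:
  assumes eq: "equiv X (\<Union>i\<in>J. S i)" and J: "J \<subseteq> {..4}" "i \<in> J" "j \<in> J"
    and k: "k \<le> 4" and pos: "coeff k i j > 0"
  shows "k \<in> J"
proof -
  have ij: "i \<le> 4" "j \<le> 4"
    using J by auto
  obtain x y where xy: "(x, y) \<in> S k"
    using rel_nonempty[OF k] by fast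
  then have "int (card {z \<in> X. (x, z) \<in> S i \<and> (z, y) \<in> S j}) = coeff k i j"
    using intersection_number[OF k ij] by (auto simp: is_intersection_number_def)
  with pos have "card {z \<in> X. (x, z) \<in> S i \<and> (z, y) \<in> S j} \<noteq> 0"
    by linarith
  then obtain z where "(x, z) \<in> S i" "(z, y) \<in> S j"
    by (metis (mono_tags, lifting) card.empty empty_Collect_eq)
  then have "(x, y) \<in> (\<Union>i\<in>J. S i)"
    using eq J unfolding equiv_def by (meson UN_I transD)
  then obtain l where "l \<in> J" "(x, y) \<in> S l"
    by blast
  with xy k J disjoint[of k l] show ?thesis
    by auto
qed

text \<open>The bound on s is essential: for s = 1 the graph is an 8-cycle, and \<open>S 0\<close>
  together with \<open>S 4\<close> is a nontrivial equivalence relation.\<close>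

lemma primitive:
  assumes s: "s \<ge> 2"
  shows "primitive_scheme X 4 S"
  unfolding primitive_scheme_def
proof (intro allI impI)
  fix J
  assume J: "J \<subseteq> {..(4::nat)}" and eq: "equiv X (\<Union>i\<in>J. S i)"
  note into = rel_in_equiv[OF eq J]
  show "(\<Union>i\<in>J. S i) = S 0 \<or> (\<Union>i\<in>J. S i) = X \<times> X"
  proof (cases "J \<subseteq> {0}")
    case True
    moreover have "J \<noteq> {}"
      using eq X_nonempty by (auto simp: equiv_def refl_on_def)
    ultimately have "J = {0}"
      by blast
    then show ?thesis
      by simp
  next
    case False
    then obtain i where i: "i \<in> J" "i \<noteq> 0" "i \<le> 4"
      using J by auto
    \<comment> \<open>The diagonal entries of \<open>M1\<close> for i = 1, ..., 4 are
      $s^{i-1}(s-1)$, which are positive exactly because s is at least 2.\<close>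
    have 1: "1 \<in> J"
      using i into[of i i 1] s unfolding le_4_iff by (auto simp: coeff_defs)
    \<comment> \<open>From \<open>S 1\<close> all distances are reached one by one: $p^{i+1}_{1i}$
      is 1, 1, 2 for i = 1, 2, 3.\<close>
    have 2: "2 \<in> J"
      using into[OF 1 1, of 2] by (simp add: coeff_defs)
    have 3: "3 \<in> J"
      using into[OF 1 2, of 3] by (simp add: coeff_defs)
    have 4: "4 \<in> J"
      using into[OF 1 3, of 4] by (simp add: coeff_defs)
    have 0: "0 \<in> J"
      using into[OF 1 1, of 0] s by (simp add: coeff_defs)
    have "J = {..4}"
      using J 0 1 2 3 4 by (auto simp: le_4_iff)
    then show ?thesis
      using cover by simp
  qed
qed

end

section \<open>Flags of a generalized quadrangle\<close>

text \<open>The relations before fusion. Pencils and lines act differently on these eight, and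
  duality permutes them inside each fused class.\<close>

definition flag_rel :: "'p set \<Rightarrow> 'l set \<Rightarrow> ('p \<Rightarrow> 'l \<Rightarrow> bool) \<Rightarrow> nat \<Rightarrow> ('p, 'l) flag_rel" where
  "flag_rel P B inc k =
     [R0 P B inc, R1 P B inc, R2 P B inc, R3 P B inc,
      R4 P B inc, R5 P B inc, R6 P B inc, R7 P B inc] ! k"

lemmas R_defs = R0_def R1_def R2_def R3_def R4_def R5_def R6_def R7_def

lemma less_8_iff: "(i::nat) < 8 \<longleftrightarrow>
    i = 0 \<or> i = 1 \<or> i = 2 \<or> i = 3 \<or> i = 4 \<or> i = 5 \<or> i = 6 \<or> i = 7"
  by auto

lemma ex_less_8_iff: "(\<exists>i<(8::nat). Q i) \<longleftrightarrow>
    Q 0 \<or> Q 1 \<or> Q 2 \<or> Q 3 \<or> Q 4 \<or> Q 5 \<or> Q 6 \<or> Q 7"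
  unfolding less_8_iff by blast

text \<open>Abstract form of the nearest-flag count: \<open>A\<close> is a line of the octagon,
  \<open>b\<close> its nearest flag, \<open>a\<close> the flag whose neighbours are summed. If
  \<open>a\<close> is nearest, all n others contribute \<open>c\<close>; otherwise one of them is
  \<open>b\<close> and n - 1 contribute \<open>c\<close>.\<close>

lemma sum_except_one:
  fixes g :: "'b \<Rightarrow> int"
  assumes "finite A" "card A = Suc n" "a \<in> A" "b \<in> A" "\<And>x. \<lbrakk>x \<in> A; x \<noteq> b\<rbrakk> \<Longrightarrow> g x = c"
  shows "(\<Sum>x\<in>A - {a}. g x) = (if a = b then int n * c else g b + (int n - 1) * c)"
proof -
  have "(\<Sum>x\<in>A. g x) = g b + (\<Sum>x\<in>A - {b}. g x)"
    using assms(1,4) by (rule sum.remove)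
  also have "(\<Sum>x\<in>A - {b}. g x) = (\<Sum>x\<in>A - {b}. c)"
    using assms by (intro sum.cong) auto
  also have "\<dots> = int n * c"
    using assms by simp
  finally have "(\<Sum>x\<in>A. g x) = g b + int n * c" .
  then show ?thesis
    using sum.remove[OF assms(1,3), of g] assms(3,5) by (auto simp: algebra_simps)
qed

context generalized_quadrangle
begin

text \<open>Turns statements about pencils into statements about the points of a line. The counting
  and uniqueness axioms are exchanged in pairs; nonemptiness of \<open>B\<close> comes from the
  positive degree of a point.\<close>

lemma dual: "generalized_quadrangle B P (\<lambda>L p. inc p L) t s"
proof
  show "B \<noteq> {}"
  proof
    assume "B = {}"
    moreover obtain p where "p \<in> P"
      using points_nonempty by blast
    ultimately show False
      using point_degree[of p] by simp
  qed
  show "\<exists>!(M, q). M \<in> B \<and> q \<in> P \<and> inc q L \<and> inc q M \<and> inc p M"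
    if "L \<in> B" "p \<in> P" "\<not> inc p L" for L p
    using projection[OF that(2,1,3)] by (auto simp: Ex1_def)
qed (use finite_points finite_lines s_pos t_pos point_degree line_size at_most_one_line
    at_most_one_point in \<open>blast+\<close>)

lemma projection_obtain:
  assumes "p \<in> P" "L \<in> B" "\<not> inc p L"
  obtains q M where "q \<in> P" "M \<in> B" "inc p M" "inc q M" "inc q L"
  using projection[OF assms] by auto

lemma projection_unique:
  assumes "p \<in> P" "L \<in> B" "\<not> inc p L"
    and "q \<in> P" "M \<in> B" "inc p M" "inc q M" "inc q L"
    and "q' \<in> P" "M' \<in> B" "inc p M'" "inc q' M'" "inc q' L"
  shows "q = q' \<and> M = M'"
  using projection[OF assms(1-3)] assms(4-) by (auto simp: Ex1_def)

section \<open>Disjointness of the eight relations\<close>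

lemma rel_disjoint_less:
  assumes "(x, y) \<in> flag_rel P B inc i" "(x, y) \<in> flag_rel P B inc j" "i < j" "j < 8"
  shows False
proof -
  obtain p L q M where x: "x = (p, L)" and y: "y = (q, M)"
    by (metis surj_pair)
  have "i < 8"
    using assms by simp
  have pq: "p \<in> P" "q \<in> P" "L \<in> B" "M \<in> B" "inc p L" "inc q M"
    using assms(1) \<open>i < 8\<close> unfolding x y flag_rel_def less_8_iff
    by (elim disjE; simp add: R_defs flags_def Id_on_def)+
  \<comment> \<open>The next five facts list the forbidden configurations: a second line through p
    and q beside \<open>L\<close> or \<open>M\<close>, a second common point of \<open>L\<close> and
    \<open>M\<close> beside p or q, and a triangle. Every overlap not excluded at once by the
    definitions produces one of them.\<close>
  have L: False if "N \<noteq> L" "N \<in> B" "inc p N" "inc q N" "inc q L" "p \<noteq> q" for N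
    using at_most_one_line that pq by metis
  have M: False if "N \<noteq> M" "N \<in> B" "inc p N" "inc q N" "inc p M" "p \<noteq> q" for N
    using at_most_one_line that pq by metis
  have p: False if "r \<noteq> p" "r \<in> P" "inc r L" "inc r M" "inc p M" "L \<noteq> M" for r
    using at_most_one_point that pq by metis
  have q: False if "r \<noteq> q" "r \<in> P" "inc r L" "inc r M" "inc q L" "L \<noteq> M" for r
    using at_most_one_point that pq by metis
  have triangle: False
    if "N \<in> B" "inc p N" "inc q N" "N \<noteq> L" "N \<noteq> M" "p \<noteq> q"
      and "r \<in> P" "inc r L" "inc r M" "r \<noteq> p" "r \<noteq> q" "L \<noteq> M" for N r
  proof -
    \<comment> \<open>A pair in both \<open>R5\<close> and \<open>R6\<close> gives a triangle p, q,
      r. Then (q, N) and (r, L) would be two projections of p onto \<open>M\<close>.\<close>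
    have "\<not> inc p M"
      using p that by blast
    then show False
      using projection_unique[of p M q N r L] pq that by blast
  qed
  have "i = 0 \<or> i = 1 \<or> i = 2 \<or> i = 3 \<or> i = 4 \<or> i = 5 \<or> i = 6"
    using assms(3,4) by linarith
  then show False
    using assms unfolding x y flag_rel_def less_8_iff
    by (elim disjE; simp add: R_defs flags_def Id_on_def; blast dest: L M p q triangle)
qed

lemma rel_disjoint:
  assumes "(x, y) \<in> flag_rel P B inc i" "(x, y) \<in> flag_rel P B inc j" "i < 8" "j < 8"
  shows "i = j"
  using rel_disjoint_less[of x y i j] rel_disjoint_less[of x y j i] assms
  by (metis linorder_neqE_nat)

section \<open>Nearest flags in pencils and on lines\<close>

text \<open>In the dihedral group indexing the eight relations, the pairs \<open>(m, n)\<close> are the cosets of one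
  of the two generating reflections; in \<open>nearest_on_line\<close> they are those of the other.\<close>

lemma nearest_in_pencil:
  assumes p: "p \<in> P" and y: "y \<in> flags P B inc"
  obtains N m n where "N \<in> B" "inc p N" "(m, n) \<in> {(0, 1), (2, 4), (3, 5), (6, 7)}"
    "((p, N), y) \<in> flag_rel P B inc m"
    "\<And>L. \<lbrakk>L \<in> B; inc p L; L \<noteq> N\<rbrakk> \<Longrightarrow> ((p, L), y) \<in> flag_rel P B inc n"
proof -
  obtain q M where y_eq: "y = (q, M)" and q: "q \<in> P" "M \<in> B" "inc q M"
    using y by (auto simp: flags_def)
  show thesis
  proof (cases "inc p M")
    case True
    show thesis
    proof (cases "p = q")
      case True
      show thesis
        by (rule that[of M 0 1])
          (use True p q in \<open>auto simp: y_eq flag_rel_def R_defs flags_def\<close>)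
    next
      case False
      show thesis
        by (rule that[of M 2 4])
          (use False \<open>inc p M\<close> p q in \<open>auto simp: y_eq flag_rel_def R_defs flags_def\<close>)
    qed
  next
    case False
    \<comment> \<open>The line projecting p onto \<open>M\<close> is nearest in the pencil. Whether
      its foot r equals q decides between the pairs (3, 5) and (6, 7).\<close>
    obtain r N where N: "r \<in> P" "N \<in> B" "inc p N" "inc r N" "inc r M"
      using projection_obtain[OF p q(2) False] .
    have unique: "r = r' \<and> N = N'"
      if "r' \<in> P" "N' \<in> B" "inc p N'" "inc r' N'" "inc r' M" for r' N'
      using projection_unique[OF p q(2) False N that] .
    show thesis
    proof (cases "r = q")
      case True
      show thesis
        by (rule that[of N 3 5])
          (use True False p q N in \<open>auto simp: y_eq flag_rel_def R_defs flags_def\<close>)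
    next
      case r: False
      \<comment> \<open>If \<open>L\<close> met \<open>M\<close>, it would be a second projection
        line of p, forcing L = N. If p and q were collinear, q would be a second foot, forcing r =
        q.\<close>
      have 7: "((p, L), y) \<in> R7 P B inc" if L: "L \<in> B" "inc p L" "L \<noteq> N" for L
        unfolding y_eq R7_def flags_def
        using p q L r unique by blast
      show thesis
        by (rule that[of N 6 7])
          (use r 7 False p q N in \<open>auto simp: y_eq flag_rel_def R6_def flags_def\<close>)
    qed
  qed
qed

text \<open>The list is the permutation induced by duality: it swaps 1 with 2, 3 with 4 and 5 with
  6, and fixes 0 and 7.\<close>

lemma flag_rel_dual:
  "((p, L), (q, M)) \<in> flag_rel P B inc k \<longleftrightarrow>
   ((L, p), (M, q)) \<in> flag_rel B P (\<lambda>L p. inc p L) ([0, 2, 1, 4, 3, 6, 5, 7] ! k)"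
  if "k < 8"
  using that unfolding less_8_iff
  by (elim disjE) (auto simp: flag_rel_def R_defs flags_def)

text \<open>This is \<open>nearest_in_pencil\<close> in the dual quadrangle; the permutation of
  \<open>flag_rel_dual\<close> carries its four pairs to the ones here.\<close>

lemma nearest_on_line:
  assumes L: "L \<in> B" and y: "y \<in> flags P B inc"
  obtains r m n where "r \<in> P" "inc r L" "(m, n) \<in> {(0, 2), (1, 3), (4, 6), (5, 7)}"
    "((r, L), y) \<in> flag_rel P B inc m"
    "\<And>p. \<lbrakk>p \<in> P; inc p L; p \<noteq> r\<rbrakk> \<Longrightarrow> ((p, L), y) \<in> flag_rel P B inc n"
proof -
  interpret dual: generalized_quadrangle B P "\<lambda>L p. inc p L" t s
    by (rule dual)
  obtain q M where y_eq: "y = (q, M)"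
    by fastforce
  have "(M, q) \<in> flags B P (\<lambda>L p. inc p L)"
    using y by (auto simp: y_eq flags_def)
  then obtain r m n where r: "r \<in> P" "inc r L" "(m, n) \<in> {(0, 1), (2, 4), (3, 5), (6, 7)}"
    "((L, r), (M, q)) \<in> flag_rel B P (\<lambda>L p. inc p L) m"
    "\<And>p. \<lbrakk>p \<in> P; inc p L; p \<noteq> r\<rbrakk> \<Longrightarrow> ((L, p), (M, q)) \<in> flag_rel B P (\<lambda>L p. inc p L) n"
    using dual.nearest_in_pencil[OF L] by metis
  show thesis
    by (rule that[of r "[0, 2, 1, 4, 3, 6, 5, 7] ! m" "[0, 2, 1, 4, 3, 6, 5, 7] ! n"])
      (use r in \<open>auto simp: y_eq flag_rel_dual\<close>)
qed

section \<open>The relation of two flags as a function, and sums over pencils and lines\<close>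

definition index :: "'p \<times> 'l \<Rightarrow> 'p \<times> 'l \<Rightarrow> nat" where
  "index x y = (THE k. k < 8 \<and> (x, y) \<in> flag_rel P B inc k)"

lemma index_eqI:
  assumes "(x, y) \<in> flag_rel P B inc k" "k < 8"
  shows "index x y = k"
  unfolding index_def using assms rel_disjoint by blast

text \<open>That the eight relations cover all pairs is a by-product of the nearest-flag lemma: (p,
  L) is either the nearest flag of its pencil or one of the others.\<close>

lemma index_less_and_rel:
  assumes "x \<in> flags P B inc" "y \<in> flags P B inc"
  shows "index x y < 8" "(x, y) \<in> flag_rel P B inc (index x y)"
proof -
  obtain p L where x: "x = (p, L)" "p \<in> P" "L \<in> B" "inc p L"
    using assms(1) by (auto simp: flags_def)
  obtain N m n where N: "(m, n) \<in> {(0, 1), (2, 4), (3, 5), (6, 7)}"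
    "((p, N), y) \<in> flag_rel P B inc m"
    "\<And>L. \<lbrakk>L \<in> B; inc p L; L \<noteq> N\<rbrakk> \<Longrightarrow> ((p, L), y) \<in> flag_rel P B inc n"
    using nearest_in_pencil[OF x(2) assms(2)] by metis
  have mn: "m < 8" "n < 8"
    using N(1) by auto
  obtain k where k: "k < 8" "(x, y) \<in> flag_rel P B inc k"
  proof (cases "L = N")
    case True
    show thesis
      by (rule that[of m]) (use True N mn x in auto)
  next
    case False
    show thesis
      by (rule that[of n]) (use False N mn x in auto)
  qed
  then show "index x y < 8" "(x, y) \<in> flag_rel P B inc (index x y)"
    using index_eqI by auto
qed

text \<open>Entry k of the list treats a flag of index k. For a nearest flag (k = 0, 2, 3, 6) the
  other t flags share one index; otherwise one of them is nearest and t - 1 have index k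
  again.\<close>

lemma sum_pencil:
  fixes f :: "nat \<Rightarrow> int"
  assumes x: "(p, L) \<in> flags P B inc" and y: "y \<in> flags P B inc"
  shows "(\<Sum>M\<in>{M \<in> B. inc p M} - {L}. f (index (p, M) y)) =
    [int t * f 1, f 0 + (int t - 1) * f 1, int t * f 4, int t * f 5,
     f 2 + (int t - 1) * f 4, f 3 + (int t - 1) * f 5,
     int t * f 7, f 6 + (int t - 1) * f 7] ! index (p, L) y"
proof -
  have p: "p \<in> P" "L \<in> B" "inc p L"
    using x by (auto simp: flags_def)
  obtain N m n where N: "N \<in> B" "inc p N" "(m, n) \<in> {(0, 1), (2, 4), (3, 5), (6, 7)}"
    "((p, N), y) \<in> flag_rel P B inc m"
    "\<And>L. \<lbrakk>L \<in> B; inc p L; L \<noteq> N\<rbrakk> \<Longrightarrow> ((p, L), y) \<in> flag_rel P B inc n"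
    using nearest_in_pencil[OF p(1) y] by metis
  have mn: "m < 8" "n < 8"
    using N(3) by auto
  have m: "index (p, N) y = m"
    using index_eqI N(4) mn by blast
  have n: "index (p, M) y = n" if "M \<in> B" "inc p M" "M \<noteq> N" for M
    using index_eqI N(5)[OF that] mn by blast
  have "(\<Sum>M\<in>{M \<in> B. inc p M} - {L}. f (index (p, M) y)) =
      (if L = N then int t * f n else f (index (p, N) y) + (int t - 1) * f n)"
    by (rule sum_except_one) (use finite_lines point_degree p N n in auto)
  moreover have "index (p, L) y = (if L = N then m else n)"
    using m n p by simp
  ultimately show ?thesis
    using N(3) m by auto
qed

lemma sum_line:
  fixes f :: "nat \<Rightarrow> int"
  assumes x: "(p, L) \<in> flags P B inc" and y: "y \<in> flags P B inc"
  shows "(\<Sum>q\<in>{q \<in> P. inc q L} - {p}. f (index (q, L) y)) =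
    [int s * f 2, int s * f 3, f 0 + (int s - 1) * f 2, f 1 + (int s - 1) * f 3,
     int s * f 6, int s * f 7,
     f 4 + (int s - 1) * f 6, f 5 + (int s - 1) * f 7] ! index (p, L) y"
proof -
  have p: "p \<in> P" "L \<in> B" "inc p L"
    using x by (auto simp: flags_def)
  obtain r m n where r: "r \<in> P" "inc r L" "(m, n) \<in> {(0, 2), (1, 3), (4, 6), (5, 7)}"
    "((r, L), y) \<in> flag_rel P B inc m"
    "\<And>p. \<lbrakk>p \<in> P; inc p L; p \<noteq> r\<rbrakk> \<Longrightarrow> ((p, L), y) \<in> flag_rel P B inc n"
    using nearest_on_line[OF p(2) y] by metis
  have mn: "m < 8" "n < 8"
    using r(3) by auto
  have m: "index (r, L) y = m"
    using index_eqI r(4) mn by blast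
  have n: "index (q, L) y = n" if "q \<in> P" "inc q L" "q \<noteq> r" for q
    using index_eqI r(5)[OF that] mn by blast
  have "(\<Sum>q\<in>{q \<in> P. inc q L} - {p}. f (index (q, L) y)) =
      (if p = r then int s * f n else f (index (r, L) y) + (int s - 1) * f n)"
    by (rule sum_except_one) (use finite_points line_size p r n in auto)
  moreover have "index (p, L) y = (if p = r then m else n)"
    using m n p by simp
  ultimately show ?thesis
    using r(3) m by auto
qed

section \<open>Fused relations as distance classes\<close>

lemma finite_flags: "finite (flags P B inc)"
  by (rule finite_subset[of _ "P \<times> B"]) (use finite_points finite_lines in \<open>auto simp: flags_def\<close>)

lemma flags_nonempty: "flags P B inc \<noteq> {}"
proof -
  obtain p where p: "p \<in> P"
    using points_nonempty by blast
  then have "{L \<in> B. inc p L} \<noteq> {}"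
    using point_degree[of p] by force
  with p show ?thesis
    by (auto simp: flags_def)
qed

definition distance :: "nat \<Rightarrow> nat" where
  "distance k = [0, 1, 1, 2, 2, 3, 3, 4] ! k"

lemma fused_rel_flags: "k \<le> 4 \<Longrightarrow> fused_rel P B inc k \<subseteq> flags P B inc \<times> flags P B inc"
  unfolding le_4_iff by (elim disjE) (auto simp: fused_rel_def R_defs)

text \<open>Membership becomes the value of a single function of the pair, from which covering and
  disjointness of the fused relations follow.\<close>

lemma fused_rel_iff:
  assumes "x \<in> flags P B inc" "y \<in> flags P B inc" "k \<le> 4"
  shows "(x, y) \<in> fused_rel P B inc k \<longleftrightarrow> distance (index x y) = k"
proof -
  have rel: "(x, y) \<in> flag_rel P B inc i \<longleftrightarrow> index x y = i" if "i < 8" for i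
    using that index_eqI index_less_and_rel(2)[OF assms(1,2)] by blast
  have "(x, y) \<in> fused_rel P B inc k \<longleftrightarrow>
      (\<exists>i<8. distance i = k \<and> (x, y) \<in> flag_rel P B inc i)"
    using assms(3) unfolding le_4_iff ex_less_8_iff
    by (elim disjE) (simp_all add: fused_rel_def flag_rel_def distance_def)
  then show ?thesis
    using rel index_less_and_rel(1)[OF assms(1,2)] by blast
qed

lemma fused_rel_sym: "k \<le> 4 \<Longrightarrow> (fused_rel P B inc k)\<inverse> = fused_rel P B inc k"
  unfolding le_4_iff by (elim disjE) (auto simp: fused_rel_def R_defs)

text \<open>The two octagon lines through a flag, its pencil and its point row, meet only in that
  flag, so the neighbour sum splits.\<close>

lemma sum_neighbours:
  fixes f :: "'p \<times> 'l \<Rightarrow> int"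
  assumes x: "(p, L) \<in> flags P B inc"
  shows "(\<Sum>z\<in>flags P B inc. of_bool (((p, L), z) \<in> fused_rel P B inc 1) * f z) =
    (\<Sum>M\<in>{M \<in> B. inc p M} - {L}. f (p, M)) + (\<Sum>q\<in>{q \<in> P. inc q L} - {p}. f (q, L))"
proof -
  let ?C = "Pair p ` ({M \<in> B. inc p M} - {L})"
  let ?D = "(\<lambda>q. (q, L)) ` ({q \<in> P. inc q L} - {p})"
  have eq: "{z \<in> flags P B inc. ((p, L), z) \<in> fused_rel P B inc 1} = ?C \<union> ?D"
    using x by (auto simp: fused_rel_def R1_def R2_def flags_def)
  have "(\<Sum>z\<in>flags P B inc. of_bool (((p, L), z) \<in> fused_rel P B inc 1) * f z) =
      (\<Sum>z\<in>{z \<in> flags P B inc. ((p, L), z) \<in> fused_rel P B inc 1}. f z)"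
    by (rule sum.mono_neutral_cong_right) (auto simp: finite_flags)
  also have "\<dots> = sum f ?C + sum f ?D"
    unfolding eq by (rule sum.union_disjoint) (auto simp: finite_lines finite_points)
  finally show ?thesis
    by (simp add: sum.reindex inj_on_def)
qed

end

section \<open>The flag graph satisfies the octagon recurrences\<close>

lemma octagon_relations_flags:
  fixes P :: "'p set" and B :: "'l set"
  assumes "generalized_quadrangle P B inc s s"
  shows "octagon_relations (flags P B inc) (fused_rel P B inc) s"
proof -
  interpret generalized_quadrangle P B inc s s
    by fact
  let ?X = "flags P B inc" and ?S = "fused_rel P B inc"
  \<comment> \<open>Entry k adds the entries k of \<open>sum_pencil\<close> and
    \<open>sum_line\<close> for t = s. In the last entry both octagon lines have their nearest flag
    at distance 3, which yields the coefficient 2 of \<open>S 4\<close> in the recurrence for j =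
    3.\<close>
  have conv: "(\<Sum>z\<in>?X. of_bool ((x, z) \<in> ?S 1) * of_bool ((z, y) \<in> ?S j)) =
     (let f = \<lambda>i. of_bool (distance i = j); s = int s in
      [s * f 1 + s * f 2,
       f 0 + (s - 1) * f 1 + s * f 3, f 0 + (s - 1) * f 2 + s * f 4,
       f 1 + (s - 1) * f 3 + s * f 5, f 2 + (s - 1) * f 4 + s * f 6,
       f 3 + (s - 1) * f 5 + s * f 7, f 4 + (s - 1) * f 6 + s * f 7,
       f 5 + f 6 + 2 * (s - 1) * f 7 :: int] ! index x y)"
    if x: "x \<in> ?X" and y: "y \<in> ?X" and j: "j \<le> 4" for x y j
  proof -
    obtain p L where pL: "x = (p, L)"
      by fastforce
    have x': "(p, L) \<in> ?X" "p \<in> P" "L \<in> B" "inc p L"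
      using x by (auto simp: pL flags_def)
    define f :: "nat \<Rightarrow> int" where "f i = of_bool (distance i = j)" for i
    have "(\<Sum>z\<in>?X. of_bool ((x, z) \<in> ?S 1) * of_bool ((z, y) \<in> ?S j)) =
        (\<Sum>z\<in>?X. of_bool ((x, z) \<in> ?S 1) * f (index z y))"
      using y j by (intro sum.cong) (auto simp: f_def fused_rel_iff)
    also have "\<dots> = (\<Sum>M\<in>{M \<in> B. inc p M} - {L}. f (index (p, M) y)) +
        (\<Sum>q\<in>{q \<in> P. inc q L} - {p}. f (index (q, L) y))"
      unfolding pL by (rule sum_neighbours[OF x'(1)])
    finally show ?thesis
      using index_less_and_rel(1)[OF x y]
      unfolding sum_pencil[OF x'(1) y] sum_line[OF x'(1) y] Let_def f_def[symmetric] less_8_iff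
      by (elim disjE) (simp_all add: pL algebra_simps)
  qed
  \<comment> \<open>The four recurrences in one statement: j selects the disjunct, and the eight
    values of the index are checked against the list in \<open>conv\<close>.\<close>
  have conv_1: "(\<Sum>z\<in>?X. of_bool ((x, z) \<in> ?S 1) * of_bool ((z, y) \<in> ?S j)) = (c :: int)"
    if "x \<in> ?X" "y \<in> ?X" "j \<le> 4" and "j = 1 \<and> c = 2 * int s * of_bool ((x, y) \<in> ?S 0) +
        (int s - 1) * of_bool ((x, y) \<in> ?S 1) + of_bool ((x, y) \<in> ?S 2) \<or>
      j = 2 \<and> c = int s * of_bool ((x, y) \<in> ?S 1) +
        (int s - 1) * of_bool ((x, y) \<in> ?S 2) + of_bool ((x, y) \<in> ?S 3) \<or>
      j = 3 \<and> c = int s * of_bool ((x, y) \<in> ?S 2) +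
        (int s - 1) * of_bool ((x, y) \<in> ?S 3) + 2 * of_bool ((x, y) \<in> ?S 4) \<or>
      j = 4 \<and> c = int s * of_bool ((x, y) \<in> ?S 3) +
        2 * (int s - 1) * of_bool ((x, y) \<in> ?S 4)" for x y j c
    using that(4) index_less_and_rel(1)[OF that(1,2)]
    unfolding conv[OF that(1-3)] less_8_iff
    by (elim disjE; simp add: fused_rel_iff that(1,2) distance_def)
  show ?thesis
  proof
    show "(\<Union>i\<le>4. ?S i) = ?X \<times> ?X"
    proof
      show "?X \<times> ?X \<subseteq> (\<Union>i\<le>4. ?S i)"
      proof clarify
        fix p L q M
        assume xy: "(p, L) \<in> ?X" "(q, M) \<in> ?X"
        have "distance (index (p, L) (q, M)) \<le> 4"
          using index_less_and_rel(1)[OF xy] unfolding less_8_iff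
          by (elim disjE) (simp_all add: distance_def)
        then show "((p, L), (q, M)) \<in> (\<Union>i\<le>4. ?S i)"
          using fused_rel_iff[OF xy] by auto
      qed
    qed (use fused_rel_flags in blast)
    show "?S i \<inter> ?S j = {}" if "i \<le> 4" "j \<le> 4" "i \<noteq> j" for i j
    proof -
      have False if "(x, y) \<in> ?S i" "(x, y) \<in> ?S j" for x y
      proof -
        have "x \<in> ?X" "y \<in> ?X"
          using that fused_rel_flags \<open>i \<le> 4\<close> by blast+
        then show False
          using that fused_rel_iff \<open>i \<le> 4\<close> \<open>j \<le> 4\<close> \<open>i \<noteq> j\<close> by metis
      qed
      then show ?thesis
        by auto
    qed
    show "?S 0 = Id_on ?X"
      by (simp add: fused_rel_def R0_def)
  qed (fact finite_flags flags_nonempty s_pos fused_rel_sym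
      | rule conv_1, assumption, assumption, simp, blast)+
qed

theorem mainTheorem9:
  fixes P :: "'p set" and B :: "'l set" and inc :: "'p \<Rightarrow> 'l \<Rightarrow> bool" and s :: nat
  assumes "generalized_quadrangle P B inc s s"
  defines "\<Omega> \<equiv> flags P B inc" and "S \<equiv> fused_rel P B inc"
  shows "association_scheme \<Omega> 4 S
    \<and> symmetric_scheme 4 S
    \<and> (s \<ge> 2 \<longrightarrow> primitive_scheme \<Omega> 4 S)
    \<and> card \<Omega> = (s + 1)^2 * (s^2 + 1)
    \<and> is_valency \<Omega> S 1 (2 * s)
    \<and> is_valency \<Omega> S 2 (2 * s^2)
    \<and> is_valency \<Omega> S 3 (2 * s^3)
    \<and> is_valency \<Omega> S 4 (s^4)
    \<and> (\<forall>i\<le>4. \<forall>j\<le>4.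
          is_intersection_number \<Omega> S 1 i j (M1 (int s) ! i ! j)
        \<and> is_intersection_number \<Omega> S 2 i j (M2 (int s) ! i ! j)
        \<and> is_intersection_number \<Omega> S 3 i j (M3 (int s) ! i ! j)
        \<and> is_intersection_number \<Omega> S 4 i j (M4 (int s) ! i ! j))"
proof -
  interpret octagon_relations \<Omega> S s "\<lambda>i x y. of_bool ((x, y) \<in> S i)"
    "\<lambda>i j x y. \<Sum>z\<in>\<Omega>. of_bool ((x, z) \<in> S i) * of_bool ((z, y) \<in> S j)"
    unfolding \<Omega>_def S_def by (rule octagon_relations_flags[OF assms(1)]) simp_all
  have "symmetric_scheme 4 S"
    using symmetric by (simp add: symmetric_scheme_def)
  moreover have "is_intersection_number \<Omega> S 1 i j (M1 (int s) ! i ! j)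
      \<and> is_intersection_number \<Omega> S 2 i j (M2 (int s) ! i ! j)
      \<and> is_intersection_number \<Omega> S 3 i j (M3 (int s) ! i ! j)
      \<and> is_intersection_number \<Omega> S 4 i j (M4 (int s) ! i ! j)" if "i \<le> 4" "j \<le> 4" for i j
    using intersection_number[of 1 i j] intersection_number[of 2 i j]
      intersection_number[of 3 i j] intersection_number[of 4 i j] that
    by (simp add: coeff_def)
  ultimately show ?thesis
    using scheme primitive card_X valencies by blast
qed

end
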